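(* Let $s\ge 1$ be an integer, $p,q\in\mathbb{C}$, $h\in\mathbb{C}\setminus\{0\}$, let $r\ge 1$, ${\bf m}=(m_1,\dots,m_r)\in\mathbb{N}_0^r$, ${\bf n}=(n_1,\dots,n_r)\in\mathbb{N}_0^r$, and let $\mathrm{w}_{{\bf m},{\bf n}}=Y^{n_r}X^{m_r}\cdots Y^{n_1}X^{m_1}$ be a word in the generators $X,Y$ of the $(p,q)$-deformed generalized Weyl algebra $A_{s;h|p,q}$. Then in $A_{s;h|p,q}$ one has $$\mathrm{w}_{{\bf m},{\bf n}}=\sum_{k=0}^{|{\bf m}|-m_1}\mathscr{R}_{s,h;p,q}[B_{\mathrm{w}_{{\bf m},{\bf n}}},k]\;Y^{|{\bf n}|+(s-1)k}Z_p^{k}X^{|{\bf m}|-k},$$ where $B_{\mathrm{w}_{{\bf m},{\bf n}}}$ is the Ferrers board associated to $\mathrm{w}_{{\bf m},{\bf n}}$, and $|{\bf m}|=\sum_j m_j$, $|{\bf n}|=\sum_j n_j$.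
   Context: $\mathbb{N}_0=\{0,1,2,\dots\}$. The algebra $A_{s;h|p,q}$ is the complex unital algebra generated by $X,Y,Z_p$ subject to $XY-qYX=hY^sZ_p$, $Z_pY=pYZ_p$, $XZ_p=pZ_pX$, with the convention $Z_1=I$ (i.e. for $p=1$ the element $Z_p$ is the identity). Ferrers board of a word. A Ferrers board is a top-justified arrangement of columns of boxes whose heights weakly decrease from left to right. For a word $w$ in $X$ and $Y$, start at $(0,0)$ and, reading $w$ from left to right, draw a unit step to the right for each $X$ and a unit step up for each $Y$. The resulting path outlines (as its lower-right boundary) the Ferrers board $B_w$. Equivalently: the columns of $B_w$, from left to right, correspond to the letters $X$ of $w$ from left to right, the rows, from bottom to top, correspond to the letters $Y$ from left to right, and there is a box in the column of a given $X$ and the row of a given $Y$ exactly when this $X$ occurs to the left of this $Y$ in $w$ (columns of height $0$ are allowed). $s$-rook placements. For $s\ge1$, $\mathcal{R}_s(B,k)$ denotes the set of placements of $k$ rooks on $B$ satisfying the $s$-row creation rule: rooks are placed going from right to left, at most one in each column; whenever a rook is placed in a box, $s$ new rows are inserted in all columns to the left of the rook, immediately beneath the row of the rook (the rook's own row also continues to the left, directly above the $s$ new rows); later rooks may be placed in the new rows, but not in the row of an earlier rook (non-attacking). Thus if $b$ rooks have been placed to the right of a column of original height $c$, that column has $c+sb$ boxes, $b$ of which lie in rows of earlier rooks and are forbidden. Weights. Given $\phi\in\mathcal{R}_s(B,k)$, the boxes of the enlarged board (including all created boxes) are divided into: rook boxes (occupied by a rook); $t$-boxes: non-rook boxes lying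 above a rook (in its column) and not lying to the left of another rook (in its row); $\ell$-boxes: non-rook boxes lying to the left of a rook (in its row) and not lying in the column of another rook; cancelled boxes: non-rook boxes lying to the left of a rook and in the column of another rook; $e$-boxes: all remaining boxes. The weight is $\omega_{s;p,q}(B;\phi)=h^kp^{\#t\text{-boxes}+\#\ell\text{-boxes}}q^{\#e\text{-boxes}}$, and the $(p,q)$-deformed $s$-rook numbers are $$\mathscr{R}_{s,h;p,q}[B,k]=\sum_{\phi\in\mathcal{R}_s(B,k)}\omega_{s;p,q}(B;\phi),$$ which is $0$ if there are no such placements. *)

theory Defs
  imports Complex_Main "HOL-Library.Poly_Mapping" "HOL-Algebra.QuotRing"
begin

section \<open>The free complex algebra on three generators\<close>

datatype gen = GX | GY | GZ

text \<open>The free monoid over \<open>'a\<close>. It is written additively because the convolution product of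
  \<^type>\<open>poly_mapping\<close> expects an additive (not necessarily commutative) monoid of exponents.\<close>

datatype 'a free_mon = Mon "'a list"

instantiation free_mon :: (type) monoid_add
begin

definition zero_free_mon :: "'a free_mon" where
  "0 = Mon []"

fun plus_free_mon :: "'a free_mon \<Rightarrow> 'a free_mon \<Rightarrow> 'a free_mon" where
  "Mon u + Mon v = Mon (u @ v)"

instance
proof
  fix a b c :: "'a free_mon"
  show "a + b + c = a + (b + c)"
    by (cases a; cases b; cases c) simp
  show "0 + a = a"
    by (cases a) (simp add: zero_free_mon_def)
  show "a + 0 = a"
    by (cases a) (simp add: zero_free_mon_def)
qed

end

type_synonym free_alg = "gen free_mon \<Rightarrow>\<^sub>0 complex"

definition gen_elem :: "gen \<Rightarrow> free_alg" where
  "gen_elem g = Poly_Mapping.single (Mon [g]) 1"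

definition scalar :: "complex \<Rightarrow> free_alg" where
  "scalar c = Poly_Mapping.single 0 c"

definition free_ring :: "free_alg ring" where
  "free_ring = \<lparr>carrier = UNIV, mult = (*), one = 1, zero = 0, add = (+)\<rparr>"

lemma ring_free_ring: "ring free_ring"
proof (rule ringI)
  show "abelian_group free_ring"
  proof (rule abelian_groupI)
    fix x assume "x \<in> carrier free_ring"
    show "\<exists>y\<in>carrier free_ring. y \<oplus>\<^bsub>free_ring\<^esub> x = \<zero>\<^bsub>free_ring\<^esub>"
      by (rule bexI[of _ "- x"]) (simp_all add: free_ring_def)
  qed (simp_all add: free_ring_def algebra_simps)
  show "monoid free_ring"
    by (rule monoidI) (simp_all add: free_ring_def algebra_simps)
qed (simp_all add: free_ring_def algebra_simps)


section \<open>The algebra \<open>A\<^bsub>s;h|p,q\<^esub>\<close>\<close>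

text \<open>Each relation \<open>u = v\<close> enters as the element \<open>u - v\<close>; the last one is the convention \<open>Z\<^sub>1 = I\<close>.\<close>

definition weyl_relators :: "nat \<Rightarrow> complex \<Rightarrow> complex \<Rightarrow> complex \<Rightarrow> free_alg set" where
  "weyl_relators s h p q =
     (let X = gen_elem GX; Y = gen_elem GY; Z = gen_elem GZ in
       {X * Y - scalar q * Y * X - scalar h * Y ^ s * Z,
        Z * Y - scalar p * Y * Z,
        X * Z - scalar p * Z * X}
       \<union> (if p = 1 then {Z - 1} else {}))"

definition weyl_ideal :: "nat \<Rightarrow> complex \<Rightarrow> complex \<Rightarrow> complex \<Rightarrow> free_alg set" where
  "weyl_ideal s h p q = Idl\<^bsub>free_ring\<^esub> (weyl_relators s h p q)"

definition weyl_algebra :: "nat \<Rightarrow> complex \<Rightarrow> complex \<Rightarrow> complex \<Rightarrow> free_alg set ring" where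
  "weyl_algebra s h p q = free_ring Quot weyl_ideal s h p q"

definition weyl_class :: "nat \<Rightarrow> complex \<Rightarrow> complex \<Rightarrow> complex \<Rightarrow> free_alg \<Rightarrow> free_alg set" where
  "weyl_class s h p q f = weyl_ideal s h p q +>\<^bsub>free_ring\<^esub> f"

text \<open>The complex algebra structure is carried by the central ring homomorphism
  \<open>c \<mapsto> weyl_class s h p q (scalar c)\<close>: the scalar multiple \<open>c a\<close> is the product of the
  class of \<open>c\<close> with \<open>a\<close>.\<close>


section \<open>Words in \<open>X\<close> and \<open>Y\<close>\<close>

datatype letter = LX | LY

fun word_prod :: "('a, 'b) ring_scheme \<Rightarrow> 'a \<Rightarrow> 'a \<Rightarrow> letter list \<Rightarrow> 'a" where
  "word_prod A x y [] = \<one>\<^bsub>A\<^esub>"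
| "word_prod A x y (LX # w) = x \<otimes>\<^bsub>A\<^esub> word_prod A x y w"
| "word_prod A x y (LY # w) = y \<otimes>\<^bsub>A\<^esub> word_prod A x y w"

text \<open>The word \<open>Y^(n r) X^(m r) \<dots> Y^(n 1) X^(m 1)\<close>; only the values of \<open>m\<close> and \<open>n\<close> at
  \<open>1, \<dots>, r\<close> matter.\<close>

definition block_word :: "nat \<Rightarrow> (nat \<Rightarrow> nat) \<Rightarrow> (nat \<Rightarrow> nat) \<Rightarrow> letter list" where
  "block_word r m n =
     concat (map (\<lambda>j. replicate (n j) LY @ replicate (m j) LX) (rev [1..<Suc r]))"


section \<open>Ferrers boards\<close>

text \<open>A top-justified board is given by the list of its column heights from left to right.
  The boxes of a column of height \<open>c\<close> are numbered \<open>0, \<dots>, c - 1\<close> from top to bottom, so that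
  (before rooks are placed) equal numbers mean equal rows.\<close>

definition ferrers_board :: "nat list \<Rightarrow> bool" where
  "ferrers_board B \<longleftrightarrow> sorted_wrt (\<ge>) B"

text \<open>The column of an \<open>X\<close> has one box for every \<open>Y\<close> further right in the word.\<close>

fun board_of_word :: "letter list \<Rightarrow> nat list" where
  "board_of_word [] = []"
| "board_of_word (LX # w) = count_list w LY # board_of_word w"
| "board_of_word (LY # w) = board_of_word w"

lemma ferrers_board_of_word: "ferrers_board (board_of_word w)"
proof -
  have "c \<le> count_list w LY" if "c \<in> set (board_of_word w)" for c w
    using that by (induction w rule: board_of_word.induct) (auto intro: le_SucI)
  then show ?thesis
    unfolding ferrers_board_def by (induction w rule: board_of_word.induct) auto
qed


section \<open>Rook placements with row creation\<close>

text \<open>A placement lists, for the columns from left to right, the rook of that column: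
  \<open>None\<close> for no rook, \<open>Some y\<close> for a rook in box \<open>y\<close>, where \<open>y\<close> is counted from the top of
  this column after the rows created by the rooks to its right have been inserted.\<close>

type_synonym placement = "nat option list"

definition num_rooks :: "placement \<Rightarrow> nat" where
  "num_rooks \<phi> = length (filter (\<lambda>x. x \<noteq> None) \<phi>)"

text \<open>\<open>rook_rows s \<phi>\<close> is the set of positions at which the rows of the rooks of \<open>\<phi>\<close> meet the
  column immediately to the left of the columns of \<open>\<phi>\<close>. A rook in box \<open>y\<close> keeps its own row at
  position \<open>y\<close> and, creating \<open>s\<close> rows directly beneath it, moves all lower rows down by \<open>s\<close>.\<close>

fun rook_rows :: "nat \<Rightarrow> placement \<Rightarrow> nat set" where
  "rook_rows s [] = {}"
| "rook_rows s (None # \<phi>) = rook_rows s \<phi>"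
| "rook_rows s (Some y # \<phi>) =
     insert y ((\<lambda>z. if z \<le> y then z else z + s) ` rook_rows s \<phi>)"

text \<open>Columns are filled from right to left, hence the recursion through the tail.\<close>

fun valid_placement :: "nat \<Rightarrow> nat list \<Rightarrow> placement \<Rightarrow> bool" where
  "valid_placement s [] [] \<longleftrightarrow> True"
| "valid_placement s (c # B) (x # \<phi>) \<longleftrightarrow>
     valid_placement s B \<phi> \<and>
     (\<forall>y. x = Some y \<longrightarrow> y < c + s * num_rooks \<phi> \<and> y \<notin> rook_rows s \<phi>)"
| "valid_placement s _ _ \<longleftrightarrow> False"

definition rook_placements :: "nat \<Rightarrow> nat list \<Rightarrow> nat \<Rightarrow> placement set" where
  "rook_placements s B k = {\<phi>. valid_placement s B \<phi> \<and> num_rooks \<phi> = k}"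


section \<open>Box types, weights and rook numbers\<close>

text \<open>Boxes of the enlarged board are pairs \<open>(i, y)\<close> of a column index (from the left, starting
  with \<open>0\<close>) and a position in this column (from the top).\<close>

definition boxes :: "nat \<Rightarrow> nat list \<Rightarrow> placement \<Rightarrow> (nat \<times> nat) set" where
  "boxes s B \<phi> = {(i, y). i < length B \<and> y < B ! i + s * num_rooks (drop (Suc i) \<phi>)}"

definition is_rook :: "placement \<Rightarrow> nat \<times> nat \<Rightarrow> bool" where
  "is_rook \<phi> = (\<lambda>(i, y). \<phi> ! i = Some y)"

definition above_rook :: "placement \<Rightarrow> nat \<times> nat \<Rightarrow> bool" where
  "above_rook \<phi> = (\<lambda>(i, y). \<exists>z. \<phi> ! i = Some z \<and> y < z)"

definition left_of_rook :: "nat \<Rightarrow> placement \<Rightarrow> nat \<times> nat \<Rightarrow> bool" where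
  "left_of_rook s \<phi> = (\<lambda>(i, y). y \<in> rook_rows s (drop (Suc i) \<phi>))"

definition in_rook_column :: "placement \<Rightarrow> nat \<times> nat \<Rightarrow> bool" where
  "in_rook_column \<phi> = (\<lambda>(i, y). \<phi> ! i \<noteq> None)"

definition t_boxes :: "nat \<Rightarrow> nat list \<Rightarrow> placement \<Rightarrow> (nat \<times> nat) set" where
  "t_boxes s B \<phi> =
     {b \<in> boxes s B \<phi>. \<not> is_rook \<phi> b \<and> above_rook \<phi> b \<and> \<not> left_of_rook s \<phi> b}"

definition l_boxes :: "nat \<Rightarrow> nat list \<Rightarrow> placement \<Rightarrow> (nat \<times> nat) set" where
  "l_boxes s B \<phi> =
     {b \<in> boxes s B \<phi>. \<not> is_rook \<phi> b \<and> left_of_rook s \<phi> b \<and> \<not> in_rook_column \<phi> b}"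

definition cancelled_boxes :: "nat \<Rightarrow> nat list \<Rightarrow> placement \<Rightarrow> (nat \<times> nat) set" where
  "cancelled_boxes s B \<phi> =
     {b \<in> boxes s B \<phi>. \<not> is_rook \<phi> b \<and> left_of_rook s \<phi> b \<and> in_rook_column \<phi> b}"

definition e_boxes :: "nat \<Rightarrow> nat list \<Rightarrow> placement \<Rightarrow> (nat \<times> nat) set" where
  "e_boxes s B \<phi> =
     {b \<in> boxes s B \<phi>. \<not> is_rook \<phi> b}
       - (t_boxes s B \<phi> \<union> l_boxes s B \<phi> \<union> cancelled_boxes s B \<phi>)"

definition rook_weight ::
  "nat \<Rightarrow> complex \<Rightarrow> complex \<Rightarrow> complex \<Rightarrow> nat list \<Rightarrow> placement \<Rightarrow> complex" where
  "rook_weight s h p q B \<phi> =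
     h ^ num_rooks \<phi> * p ^ (card (t_boxes s B \<phi>) + card (l_boxes s B \<phi>))
       * q ^ card (e_boxes s B \<phi>)"

definition rook_number ::
  "nat \<Rightarrow> complex \<Rightarrow> complex \<Rightarrow> complex \<Rightarrow> nat list \<Rightarrow> nat \<Rightarrow> complex" where
  "rook_number s h p q B k = (\<Sum>\<phi>\<in>rook_placements s B k. rook_weight s h p q B \<phi>)"

text \<open>The sum above is finite, so it does not collapse to the default value of \<^const>\<open>sum\<close>.\<close>

lemma finite_rook_placements: "finite (rook_placements s B k)"
proof -
  have "finite {\<phi>. valid_placement s B \<phi>}"
  proof (induction B)
    case Nil
    have "{\<phi>. valid_placement s [] \<phi>} \<subseteq> {[]}"
    proof
      fix \<phi> assume "\<phi> \<in> {\<phi>. valid_placement s [] \<phi>}"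
      then show "\<phi> \<in> {[]}" by (cases \<phi>) auto
    qed
    then show ?case by (rule finite_subset) simp
  next
    case (Cons c B)
    let ?S = "{\<phi>. valid_placement s B \<phi>}"
    let ?T = "\<Union>\<phi>\<in>?S. (\<lambda>x. x # \<phi>) ` insert None (Some ` {..<c + s * num_rooks \<phi>})"
    have "{\<phi>. valid_placement s (c # B) \<phi>} \<subseteq> ?T"
    proof
      fix \<phi> assume *: "\<phi> \<in> {\<phi>. valid_placement s (c # B) \<phi>}"
      then obtain x \<psi> where \<phi>: "\<phi> = x # \<psi>" by (cases \<phi>) auto
      with * have "x \<in> insert None (Some ` {..<c + s * num_rooks \<psi>})" "\<psi> \<in> ?S"
        by (cases x; auto)+
      with \<phi> show "\<phi> \<in> ?T" by blast
    qed
    moreover have "finite ?T" using Cons.IH by blast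
    ultimately show ?case by (rule finite_subset)
  qed
  then show ?thesis
    by (rule rev_finite_subset) (auto simp: rook_placements_def)
qed

end

theory Submission
  imports Defs
begin

text \<open>
  Read a word from right to left. Prefixing \<open>Y\<close> changes neither the board nor the coefficients of
  the normal ordering. Prefixing \<open>X\<close> adds a leftmost column of full height; once \<open>k\<close> rooks are
  placed to its right, exactly \<open>a = |n| + (s - 1) k\<close> of its boxes are not in the row of a rook. On the
  algebraic side \<open>X Y^a = q^a Y^a X + h [a] Y^(a + s - 1) Z\<close> with the \<open>(p,q)\<close>-number
  \<open>[a] = \<Sum>i<a. p^i q^(a - 1 - i)\<close>: the first summand (together with \<open>X Z^k = p^k Z^k X\<close>) is the
  weight of the empty new column, and the terms of the second one are the weights of the
  \<open>a\<close> possible rooks in it.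
\<close>

section \<open>(p,q)-numbers as generating functions of ranks\<close>

text \<open>Division-free form of (p^a - q^a) / (p - q), which also covers p = q.\<close>

definition pq_number :: "complex \<Rightarrow> complex \<Rightarrow> nat \<Rightarrow> complex" where
  "pq_number p q a = (\<Sum>i<a. p ^ i * q ^ (a - Suc i))"

lemma pq_number_0 [simp]: "pq_number p q 0 = 0"
  by (simp add: pq_number_def)

lemma pq_number_Suc: "pq_number p q (Suc a) = q * pq_number p q a + p ^ a"
proof -
  have "(\<Sum>i<a. p ^ i * q ^ (a - i)) = (\<Sum>i<a. q * (p ^ i * q ^ (a - Suc i)))"
    by (intro sum.cong refl) (simp add: Suc_diff_Suc flip: power_Suc)
  then show ?thesis
    by (simp add: pq_number_def sum_distrib_left)
qed

text \<open>The factor \<open>p\<close> is what a \<open>Z\<close> passing one more \<open>Y\<close>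
  produces. This version serves the commutation of \<open>X\<close> with powers of \<open>Y\<close>,
  \<open>pq_number_Suc\<close> the counting of rooks.\<close>

lemma pq_number_Suc': "pq_number p q (Suc a) = p * pq_number p q a + q ^ a"
proof (induction a)
  case (Suc a)
  have "pq_number p q (Suc (Suc a)) = q * pq_number p q (Suc a) + p ^ Suc a"
    by (rule pq_number_Suc)
  also have "\<dots> = q * (p * pq_number p q a + q ^ a) + p ^ Suc a"
    by (simp only: Suc.IH)
  also have "\<dots> = p * pq_number p q (Suc a) + q ^ Suc a"
    by (simp add: pq_number_Suc algebra_simps)
  finally show ?case .
qed (simp add: pq_number_Suc)

text \<open>The element of rank \<open>i\<close> in \<open>F\<close> contributes
  \<open>p ^ i * q ^ (card F - 1 - i)\<close>. Inserting a new maximum puts one more element above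
  every old one (a factor \<open>q\<close>) and adds the term \<open>p ^ card F\<close>.\<close>

lemma sum_rank_eq_pq_number:
  fixes F :: "nat set"
  assumes "finite F"
  shows "(\<Sum>y\<in>F. p ^ card {z\<in>F. z < y} * q ^ card {z\<in>F. y < z}) = pq_number p q (card F)"
  using assms
proof (induction F rule: finite_linorder_max_induct)
  case (insert b F)
  have b: "b \<notin> F" using insert.hyps by blast
  have below: "card {z\<in>insert b F. z < y} = card {z\<in>F. z < y}" if "y \<in> F" for y
    using that insert.hyps by (intro arg_cong[of _ _ card]) auto
  have above: "card {z\<in>insert b F. y < z} = Suc (card {z\<in>F. y < z})" if "y \<in> F" for y
  proof -
    have "{z\<in>insert b F. y < z} = insert b {z\<in>F. y < z}"
      using that insert.hyps by auto
    then show ?thesis using insert.hyps b by simp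
  qed
  have top: "{z\<in>insert b F. z < b} = F" "{z\<in>insert b F. b < z} = {}"
    using insert.hyps by (auto dest: less_asym)
  have "(\<Sum>y\<in>F. p ^ card {z\<in>insert b F. z < y} * q ^ card {z\<in>insert b F. y < z}) =
      (\<Sum>y\<in>F. q * (p ^ card {z\<in>F. z < y} * q ^ card {z\<in>F. y < z}))"
    by (intro sum.cong refl) (simp only: below above power_Suc mult_ac)
  then show ?case
    unfolding sum.insert[OF insert.hyps(1) b] top
    using insert.hyps b insert.IH by (simp add: pq_number_Suc flip: sum_distrib_left)
qed simp


section \<open>Recursion for the rook numbers\<close>

lemma finite_boxes: "finite (boxes s B \<phi>)"
proof (rule finite_subset)
  show "boxes s B \<phi> \<subseteq> (SIGMA i:{..<length B}. {..<B ! i + s * num_rooks (drop (Suc i) \<phi>)})"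
    by (auto simp: boxes_def)
qed simp

lemma num_rooks_simps [simp]:
  "num_rooks [] = 0" "num_rooks (None # \<psi>) = num_rooks \<psi>"
  "num_rooks (Some y # \<psi>) = Suc (num_rooks \<psi>)"
  by (simp_all add: num_rooks_def)

section \<open>Rows of rooks in a new column\<close>

text \<open>A rook shifts rows down by at most \<open>s\<close>, which is the growth of the columns
  to its left. As \<open>c\<close> bounds all heights, every such row fits into a column of original
  height \<open>c\<close>.\<close>

lemma rook_rows_subset:
  assumes "valid_placement s B \<psi>" "\<And>b. b \<in> set B \<Longrightarrow> b \<le> c"
  shows "rook_rows s \<psi> \<subseteq> {..<c + s * num_rooks \<psi>}"
  using assms
proof (induction s B \<psi> rule: valid_placement.induct)
  case (2 s b B x \<psi>)
  then have IH: "rook_rows s \<psi> \<subseteq> {..<c + s * num_rooks \<psi>}" by simp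
  show ?case
  proof (cases x)
    case (Some y)
    then have "y < c + s * num_rooks \<psi>"
      using "2.prems" by (fastforce intro: less_le_trans)
    with IH Some show ?thesis by fastforce
  qed (use IH in simp)
qed auto

lemma finite_rook_rows: "finite (rook_rows s \<psi>)"
  by (induction s \<psi> rule: rook_rows.induct) auto

text \<open>Distinct rows stay distinct: the shift is injective and cannot reach \<open>y\<close>,
  since positions up to \<open>y\<close> are fixed, \<open>y\<close> itself was not occupied, and
  the others remain below it.\<close>

lemma card_rook_rows:
  assumes "valid_placement s B \<psi>"
  shows "card (rook_rows s \<psi>) = num_rooks \<psi>"
  using assms
proof (induction s B \<psi> rule: valid_placement.induct)
  case (2 s b B x \<psi>)
  then have IH: "card (rook_rows s \<psi>) = num_rooks \<psi>" by simp
  show ?case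
  proof (cases x)
    case (Some y)
    define f where "f z = (if z \<le> y then z else z + s)" for z
    have "inj f" by (auto simp: inj_on_def f_def split: if_splits)
    moreover have "y \<notin> f ` rook_rows s \<psi>"
      using "2.prems" Some by (auto simp: f_def split: if_splits)
    moreover have "rook_rows s (x # \<psi>) = insert y (f ` rook_rows s \<psi>)"
      by (simp only: Some rook_rows.simps f_def[abs_def])
    ultimately show ?thesis
      using IH Some finite_rook_rows[of s \<psi>] by (simp add: card_image inj_on_subset)
  qed (use IH in simp)
qed auto

section \<open>Splitting off the leftmost column\<close>

lemma card_split_first_column:
  fixes S :: "(nat \<times> nat) set"
  assumes "finite S"
  shows "card S = card {y. (0, y) \<in> S} + card {(i, y). (Suc i, y) \<in> S}"
proof -
  let ?f = "\<lambda>y. (0 :: nat, y :: nat)" and ?g = "\<lambda>(i, y :: nat). (Suc i, y)"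
  have S: "S = ?f ` {y. (0, y) \<in> S} \<union> ?g ` {(i, y). (Suc i, y) \<in> S}" (is "_ = ?A \<union> ?B")
  proof (rule Set.set_eqI)
    fix b :: "nat \<times> nat"
    obtain i y where "b = (i, y)" by (cases b)
    then show "b \<in> S \<longleftrightarrow> b \<in> ?A \<union> ?B" by (cases i) (auto simp: image_iff)
  qed
  have "finite ?A" "finite ?B"
    using assms S by (metis finite_Un)+
  moreover have "?A \<inter> ?B = {}" by auto
  ultimately have "card S = card ?A + card ?B"
    using S card_Un_disjoint by metis
  then show ?thesis
    by (simp add: card_image inj_on_def split_def prod_eq_iff)
qed

text \<open>Here \<open>F\<close> stands for the set of positions in the column outside the rows of the \<open>b\<close> rooks to its
  right.\<close>

definition column_weight ::
  "complex \<Rightarrow> complex \<Rightarrow> complex \<Rightarrow> nat set \<Rightarrow> nat \<Rightarrow> nat option \<Rightarrow> complex" where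
  "column_weight h p q F b x =
     (case x of None \<Rightarrow> p ^ b * q ^ card F
      | Some y \<Rightarrow> h * (p ^ card {z\<in>F. z < y} * q ^ card {z\<in>F. y < z}))"

text \<open>Rows are created only to the left of a rook, so the leftmost column does not affect the
  types of the other boxes. The Ferrers condition ensures that all rows of rooks meet the new
  column.\<close>

lemma rook_weight_Cons:
  fixes s c :: nat
  defines "F \<equiv> \<lambda>\<psi>. {..<c + s * num_rooks \<psi>} - rook_rows s \<psi>"
  assumes B: "ferrers_board (c # B)" and valid: "valid_placement s (c # B) (x # \<psi>)"
  shows "rook_weight s h p q (c # B) (x # \<psi>) =
    column_weight h p q (F \<psi>) (num_rooks \<psi>) x * rook_weight s h p q B \<psi>"
proof -
  let ?B = "c # B" and ?\<phi> = "x # \<psi>"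
  let ?H = "{..<c + s * num_rooks \<psi>}" and ?R = "rook_rows s \<psi>"
  have valid': "valid_placement s B \<psi>" using valid by simp
  have R: "?R \<subseteq> ?H" "card ?R = num_rooks \<psi>"
    using rook_rows_subset[OF valid'] card_rook_rows[OF valid'] B
    by (auto simp: ferrers_board_def)
  note box_defs = t_boxes_def l_boxes_def e_boxes_def cancelled_boxes_def boxes_def is_rook_def
    above_rook_def left_of_rook_def in_rook_column_def
  have fin: "finite (t_boxes s ?B ?\<phi>)" "finite (l_boxes s ?B ?\<phi>)" "finite (e_boxes s ?B ?\<phi>)"
    using finite_boxes[of s ?B ?\<phi>]
    by (auto simp: t_boxes_def l_boxes_def e_boxes_def)
  have tail:
    "{(i, y). (Suc i, y) \<in> t_boxes s ?B ?\<phi>} = t_boxes s B \<psi>"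
    "{(i, y). (Suc i, y) \<in> l_boxes s ?B ?\<phi>} = l_boxes s B \<psi>"
    "{(i, y). (Suc i, y) \<in> e_boxes s ?B ?\<phi>} = e_boxes s B \<psi>"
    by (auto simp: box_defs)
  \<comment> \<open>In an empty column the boxes in rows of rooks are l-boxes and the rest are
    e-boxes. In a column with a rook at \<open>y\<close> the former are cancelled, and the free
    boxes are t-boxes above \<open>y\<close> and e-boxes below.\<close>
  have head:
    "{y. (0, y) \<in> t_boxes s ?B ?\<phi>} = (case x of None \<Rightarrow> {} | Some y \<Rightarrow> {z\<in>F \<psi>. z < y})"
    "{y. (0, y) \<in> l_boxes s ?B ?\<phi>} = (case x of None \<Rightarrow> ?R | Some y \<Rightarrow> {})"
    "{y. (0, y) \<in> e_boxes s ?B ?\<phi>} = (case x of None \<Rightarrow> F \<psi> | Some y \<Rightarrow> {z\<in>F \<psi>. y < z})"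
    using R(1) by (auto simp: box_defs F_def split: option.splits)
  show ?thesis
    unfolding rook_weight_def card_split_first_column[OF fin(1)]
      card_split_first_column[OF fin(2)] card_split_first_column[OF fin(3)] tail head
    by (cases x) (simp_all add: column_weight_def R(2) power_add mult_ac)
qed

text \<open>Placements are sorted by whether the leftmost column is empty. If it is not, its rook
  runs over the free positions, whose rank weights add up to a (p,q)-number.\<close>

lemma rook_number_Cons:
  assumes B: "ferrers_board (c # B)" and s: "s \<ge> 1"
  shows "rook_number s h p q (c # B) k =
    p ^ k * q ^ (c + (s - 1) * k) * rook_number s h p q B k +
    (case k of 0 \<Rightarrow> 0
     | Suc j \<Rightarrow> h * pq_number p q (c + (s - 1) * j) * rook_number s h p q B j)"
proof -
  define F where "F \<psi> = {..<c + s * num_rooks \<psi>} - rook_rows s \<psi>" for \<psi>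
  let ?w = "rook_weight s h p q" and ?cw = "column_weight h p q"
  define P0 where "P0 = (#) None ` rook_placements s B k"
  \<comment> \<open>Writing \<open>Suc (num_rooks \<psi>) = k\<close> instead of using
    \<open>k - 1\<close> makes \<open>P1\<close> empty for \<open>k = 0\<close>.\<close>
  define P1 where "P1 =
    (\<lambda>(\<psi>, y). Some y # \<psi>) ` (SIGMA \<psi>:{\<psi>. valid_placement s B \<psi> \<and> Suc (num_rooks \<psi>) = k}. F \<psi>)"
  \<comment> \<open>With \<open>b\<close> earlier rooks, \<open>b\<close> of the
    \<open>c + s * b\<close> boxes lie in their rows; \<open>s \<ge> 1\<close> keeps the subtraction
    exact.\<close>
  have card_F: "card (F \<psi>) = c + (s - 1) * num_rooks \<psi>" if "valid_placement s B \<psi>" for \<psi>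
  proof -
    have "rook_rows s \<psi> \<subseteq> {..<c + s * num_rooks \<psi>}"
      using rook_rows_subset[OF that] B by (auto simp: ferrers_board_def)
    then have "card (F \<psi>) = c + s * num_rooks \<psi> - num_rooks \<psi>"
      using card_rook_rows[OF that] by (simp add: F_def card_Diff_subset finite_rook_rows)
    then show ?thesis
      using s by (cases s) simp_all
  qed
  have split: "rook_placements s (c # B) k = P0 \<union> P1"
  proof (rule Set.set_eqI)
    fix \<phi>
    show "\<phi> \<in> rook_placements s (c # B) k \<longleftrightarrow> \<phi> \<in> P0 \<union> P1"
    proof (cases \<phi>)
      case (Cons x \<psi>)
      then show ?thesis
        by (cases x) (auto simp: rook_placements_def P0_def P1_def F_def image_iff)
    qed (auto simp: rook_placements_def P0_def P1_def)
  qed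
  have fin: "finite P0" "finite P1"
    using finite_rook_placements[of s "c # B" k] by (simp_all add: split)
  have sum0: "sum (?w (c # B)) P0 = p ^ k * q ^ (c + (s - 1) * k) * rook_number s h p q B k"
  proof -
    have "sum (?w (c # B)) P0 = (\<Sum>\<psi>\<in>rook_placements s B k. ?w (c # B) (None # \<psi>))"
      by (simp add: P0_def sum.reindex)
    also have "\<dots> = (\<Sum>\<psi>\<in>rook_placements s B k. p ^ k * q ^ (c + (s - 1) * k) * ?w B \<psi>)"
      by (intro sum.cong refl, subst rook_weight_Cons[OF B])
         (auto simp: rook_placements_def column_weight_def card_F simp flip: F_def)
    finally show ?thesis
      by (simp add: rook_number_def sum_distrib_left)
  qed
  have sum1: "sum (?w (c # B)) P1 = (case k of 0 \<Rightarrow> 0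
     | Suc j \<Rightarrow> h * pq_number p q (c + (s - 1) * j) * rook_number s h p q B j)"
  proof (cases k)
    case (Suc j)
    have "inj_on (\<lambda>(\<psi>, y). Some y # \<psi>) (SIGMA \<psi>:rook_placements s B j. F \<psi>)"
      by (auto simp: inj_on_def)
    then have "sum (?w (c # B)) P1 =
        (\<Sum>(\<psi>, y)\<in>(SIGMA \<psi>:rook_placements s B j. F \<psi>). ?w (c # B) (Some y # \<psi>))"
      by (simp add: P1_def Suc sum.reindex split_def flip: rook_placements_def)
    also have "\<dots> = (\<Sum>\<psi>\<in>rook_placements s B j. \<Sum>y\<in>F \<psi>. ?w (c # B) (Some y # \<psi>))"
      by (intro sum.Sigma[symmetric]) (simp_all add: finite_rook_placements F_def)
    also have "\<dots> = (\<Sum>\<psi>\<in>rook_placements s B j. h * pq_number p q (c + (s - 1) * j) * ?w B \<psi>)"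
    proof (intro sum.cong refl)
      fix \<psi> assume "\<psi> \<in> rook_placements s B j"
      then have \<psi>: "valid_placement s B \<psi>" "num_rooks \<psi> = j"
        by (auto simp: rook_placements_def)
      have "(\<Sum>y\<in>F \<psi>. ?w (c # B) (Some y # \<psi>)) =
          (\<Sum>y\<in>F \<psi>. ?cw (F \<psi>) (num_rooks \<psi>) (Some y) * ?w B \<psi>)"
        by (intro sum.cong refl, subst rook_weight_Cons[OF B]) (use \<psi> in \<open>auto simp: F_def\<close>)
      also have "\<dots> = h * (\<Sum>y\<in>F \<psi>. p ^ card {z\<in>F \<psi>. z < y} * q ^ card {z\<in>F \<psi>. y < z}) * ?w B \<psi>"
        by (simp add: column_weight_def sum_distrib_left sum_distrib_right)
      also have "\<dots> = h * pq_number p q (c + (s - 1) * j) * ?w B \<psi>"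
        using \<psi> card_F[OF \<psi>(1)] by (subst sum_rank_eq_pq_number) (simp_all add: F_def)
      finally show "(\<Sum>y\<in>F \<psi>. ?w (c # B) (Some y # \<psi>)) =
          h * pq_number p q (c + (s - 1) * j) * ?w B \<psi>" .
    qed
    finally show ?thesis
      by (simp add: Suc rook_number_def sum_distrib_left)
  qed (simp add: P1_def)
  have "P0 \<inter> P1 = {}"
    by (auto simp: P0_def P1_def)
  with fin show ?thesis
    unfolding rook_number_def[of s h p q "c # B"] split
    by (simp add: sum.union_disjoint sum0 sum1)
qed

lemma rook_number_LX:
  assumes "s \<ge> 1"
  shows "rook_number s h p q (board_of_word (LX # w)) k =
    p ^ k * q ^ (count_list w LY + (s - 1) * k) * rook_number s h p q (board_of_word w) k +
    (case k of 0 \<Rightarrow> 0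
     | Suc j \<Rightarrow> h * pq_number p q (count_list w LY + (s - 1) * j) *
         rook_number s h p q (board_of_word w) j)"
  using rook_number_Cons[OF _ assms] ferrers_board_of_word[of "LX # w"] by simp

section \<open>Vanishing of rook numbers\<close>

lemma rook_number_Nil: "rook_number s h p q [] k = (if k = 0 then 1 else 0)"
proof -
  have "rook_placements s [] k = (if k = 0 then {[]} else {})"
    by (auto simp: rook_placements_def elim: valid_placement.elims)
  then show ?thesis
    by (simp add: rook_number_def rook_weight_def t_boxes_def l_boxes_def e_boxes_def boxes_def)
qed

lemma count_list_replicate: "count_list (replicate n a) b = (if a = b then n else 0)"
  by (induction n) auto

text \<open>A column of height 0 without rooks to its right has the factor
  \<open>pq_number p q 0 = 0\<close> in the recursion, so a first rook can never be placed.\<close>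

lemma rook_number_replicate_LX:
  assumes "s \<ge> 1"
  shows "rook_number s h p q (board_of_word (replicate m LX)) k = (if k = 0 then 1 else 0)"
proof (induction m arbitrary: k)
  case (Suc m)
  then show ?case
    using rook_number_LX[OF assms, of _ _ _ "replicate m LX"]
    by (simp add: count_list_replicate split: nat.split)
qed (simp add: rook_number_Nil)

text \<open>The columns of the trailing \<open>X\<close>s hold no rooks, and each column of
  \<open>u\<close> holds at most one. This bounds the range of summation in the normal
  ordering.\<close>

lemma rook_number_eq_0:
  assumes "s \<ge> 1" and "k > count_list u LX"
  shows "rook_number s h p q (board_of_word (u @ replicate m LX)) k = 0"
  using assms(2)
proof (induction u arbitrary: k)
  case (Cons a u)
  show ?case
  proof (cases a)
    case LX
    then show ?thesis
      using Cons rook_number_LX[OF assms(1), of _ _ _ "u @ replicate m LX"]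
      by (auto split: nat.split)
  qed (use Cons in auto)
qed (simp add: rook_number_replicate_LX[OF assms(1)])


section \<open>Normal ordering\<close>

lemma mult_commute_scalar: "f * scalar c = scalar c * f"
proof -
  have "Poly_Mapping.single m d * scalar c = scalar c * Poly_Mapping.single m d" for m d
    by (simp add: scalar_def mult_single mult.commute)
  \<comment> \<open>The induction assembles \<open>f\<close> by updates at new exponents; such an
    update is an addition because the old coefficient is 0.\<close>
  moreover have "Poly_Mapping.update m d f = f + Poly_Mapping.single m d"
    if "m \<notin> Poly_Mapping.keys f" for m d and f :: free_alg
  proof -
    have "poly_mapping.lookup f m = 0" using that by (simp add: in_keys_iff)
    then show ?thesis
      by (intro poly_mapping_eqI) (auto simp: lookup_update lookup_add lookup_single when_def)
  qed
  ultimately show ?thesis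
    by (induction f rule: update_induct) (simp_all add: algebra_simps)
qed

lemma scalar_add: "scalar (a + b) = scalar a + scalar b"
  by (simp add: scalar_def single_add)

lemma scalar_mult: "scalar (a * b) = scalar a * scalar b"
  by (simp add: scalar_def mult_single)

lemma scalar_0 [simp]: "scalar 0 = 0" and scalar_1 [simp]: "scalar 1 = 1"
  by (simp_all add: scalar_def)

lemma free_ring_simps [simp]:
  "carrier free_ring = UNIV" "f \<otimes>\<^bsub>free_ring\<^esub> g = f * g" "f \<oplus>\<^bsub>free_ring\<^esub> g = f + g"
  "\<one>\<^bsub>free_ring\<^esub> = 1" "\<zero>\<^bsub>free_ring\<^esub> = 0"
  by (simp_all add: free_ring_def)

lemma free_ring_pow [simp]: "f [^]\<^bsub>free_ring\<^esub> (n :: nat) = f ^ n"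
  by (induction n) (simp_all add: nat_pow_def power_commutes)

section \<open>Computation modulo the ideal of relations\<close>

context
  fixes s :: nat and h p q :: complex
begin

private abbreviation (input) "A \<equiv> weyl_algebra s h p q"
private abbreviation (input) "cls \<equiv> weyl_class s h p q"
private abbreviation (input) "X \<equiv> gen_elem GX"
private abbreviation (input) "Y \<equiv> gen_elem GY"
private abbreviation (input) "Z \<equiv> gen_elem GZ"

lemma ideal_weyl_ideal: "ideal (weyl_ideal s h p q) free_ring"
  unfolding weyl_ideal_def by (rule ring.genideal_ideal[OF ring_free_ring]) simp

lemma ring_hom_cls: "ring_hom_ring free_ring A cls"
  unfolding weyl_algebra_def weyl_class_def[abs_def]
  by (rule ideal.rcos_ring_hom_ring[OF ideal_weyl_ideal])

interpretation cls: ring_hom_ring free_ring A cls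
  by (rule ring_hom_cls)

lemma cls_carrier [simp]: "cls f \<in> carrier A"
  by (rule cls.hom_closed) simp

lemma cls_add: "cls (f + g) = cls f \<oplus>\<^bsub>A\<^esub> cls g"
  using cls.hom_add[of f g] by simp

lemma cls_mult: "cls (f * g) = cls f \<otimes>\<^bsub>A\<^esub> cls g"
  using cls.hom_mult[of f g] by simp

lemma cls_pow: "cls (f ^ n) = cls f [^]\<^bsub>A\<^esub> (n :: nat)"
  using cls.hom_nat_pow[of f n] by simp

lemma cls_sum: "cls (sum f {0..n}) = (\<Oplus>\<^bsub>A\<^esub> k\<in>{0..n :: nat}. cls (f k))"
proof -
  have "cls (sum f {..n}) = (\<Oplus>\<^bsub>A\<^esub> k\<in>{..n}. cls (f k))"
    by (induction n) (simp_all add: cls_add cls.S.a_comm)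
  then show ?thesis by (simp add: atLeast0AtMost)
qed

lemma cls_word_prod: "cls (word_prod free_ring X Y w) = word_prod A (cls X) (cls Y) w"
  by (induction w rule: board_of_word.induct) (simp_all add: cls_mult cls.hom_one[simplified])

text \<open>The entry point of the defining relations. Calculations stay in the free algebra, as
  equations between classes, and move to the operations of \<open>A\<close> only at the end.\<close>

lemma cls_eqI:
  assumes "f - g \<in> weyl_relators s h p q"
  shows "cls f = cls g"
proof -
  have "f - g \<in> weyl_ideal s h p q"
    using assms ring.genideal_self[OF ring_free_ring, of "weyl_relators s h p q"]
    by (auto simp: weyl_ideal_def)
  then have "cls (f - g) = \<zero>\<^bsub>A\<^esub>"
    using ring.a_rcos_zero[OF ring_free_ring ideal_weyl_ideal]
    by (simp add: weyl_class_def weyl_algebra_def FactRing_def)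
  then have "cls (f - g + g) = cls g"
    by (simp only: cls_add cls_carrier cls.S.l_zero)
  then show ?thesis by simp
qed

text \<open>Replaces a factor inside a noncommutative product; the calculations below insert a
  \<open>1\<close> where one side is empty.\<close>

lemma cls_mult_cong: "cls f = cls g \<Longrightarrow> cls (u * f * v) = cls (u * g * v)"
  by (simp add: cls_mult)

lemma cls_add_cong: "cls f = cls f' \<Longrightarrow> cls g = cls g' \<Longrightarrow> cls (f + g) = cls (f' + g')"
  by (simp add: cls_add)

lemma cls_sum_cong:
  "(\<And>k. k \<le> n \<Longrightarrow> cls (f k) = cls (g k)) \<Longrightarrow> cls (sum f {..n}) = cls (sum g {..n :: nat})"
  by (induction n) (simp_all add: cls_add)

section \<open>Moving X past powers of Y and Z\<close>

lemma cls_X_Y: "cls (X * Y) = cls (scalar q * Y * X + scalar h * Y ^ s * Z)"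
  by (rule cls_eqI) (simp add: weyl_relators_def Let_def diff_diff_eq)

lemma cls_Z_Y: "cls (Z * Y) = cls (scalar p * Y * Z)"
  by (rule cls_eqI) (simp add: weyl_relators_def Let_def)

lemma cls_X_Z: "cls (X * Z) = cls (scalar p * Z * X)"
  by (rule cls_eqI) (simp add: weyl_relators_def Let_def)

text \<open>Each \<open>Z\<close> costs a factor \<open>p\<close>; \<open>p ^ k\<close> matches the
  l-boxes of an empty new column in the rows of \<open>k\<close> earlier rooks.\<close>

lemma cls_X_Z_pow: "cls (X * Z ^ k) = cls (scalar (p ^ k) * Z ^ k * X)"
proof (induction k)
  case (Suc k)
  have "cls (X * Z ^ Suc k) = cls (1 * (X * Z ^ k) * Z)"
    by (simp add: power_Suc2 mult.assoc del: power_Suc)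
  also have "\<dots> = cls (1 * (scalar (p ^ k) * Z ^ k * X) * Z)"
    by (intro cls_mult_cong Suc.IH)
  also have "\<dots> = cls (scalar (p ^ k) * Z ^ k * (X * Z) * 1)"
    by (simp add: mult.assoc)
  also have "\<dots> = cls (scalar (p ^ k) * Z ^ k * (scalar p * Z * X) * 1)"
    by (intro cls_mult_cong cls_X_Z)
  also have "scalar (p ^ k) * Z ^ k * (scalar p * Z * X) * 1 = scalar (p ^ Suc k) * Z ^ Suc k * X"
    by (simp add: power_Suc2 scalar_mult mult.assoc mult_commute_scalar[of "Z ^ k"] del: power_Suc
        flip: mult.assoc[of "Z ^ k" "scalar p"])
  finally show ?case .
qed simp

text \<open>Multiply by one more \<open>Y\<close> on the right. The \<open>X\<close>-term yields
  \<open>q ^ Suc a\<close> and a new \<open>Z\<close>-term with \<open>h * q ^ a\<close>; in the old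
  \<open>Z\<close>-term, \<open>Z\<close> passes \<open>Y\<close> with a factor \<open>p\<close>.
  Hence \<open>pq_number_Suc'\<close> gives the coefficient.\<close>

lemma cls_X_Y_pow:
  assumes "s \<ge> 1"
  shows "cls (X * Y ^ a) =
    cls (scalar (q ^ a) * Y ^ a * X + scalar (h * pq_number p q a) * Y ^ (a + (s - 1)) * Z)"
proof (induction a)
  case (Suc a)
  let ?C = "scalar (h * pq_number p q a)" and ?Q = "scalar (q ^ a)" and ?t = "s - 1"
  have "cls (X * Y ^ Suc a) = cls (1 * (X * Y ^ a) * Y)"
    by (simp add: power_Suc2 mult.assoc del: power_Suc)
  also have "\<dots> = cls (1 * (?Q * Y ^ a * X + ?C * Y ^ (a + ?t) * Z) * Y)"
    by (intro cls_mult_cong Suc.IH)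
  also have "\<dots> = cls (?Q * Y ^ a * (X * Y) * 1 + ?C * Y ^ (a + ?t) * (Z * Y) * 1)"
    by (simp add: algebra_simps)
  also have "\<dots> = cls (?Q * Y ^ a * (scalar q * Y * X + scalar h * Y ^ s * Z) * 1 +
      ?C * Y ^ (a + ?t) * (scalar p * Y * Z) * 1)"
    by (intro cls_add_cong cls_mult_cong cls_X_Y cls_Z_Y)
  also have "?Q * Y ^ a * (scalar q * Y * X + scalar h * Y ^ s * Z) * 1 +
      ?C * Y ^ (a + ?t) * (scalar p * Y * Z) * 1 =
      ?Q * (Y ^ a * scalar q) * Y * X + ?Q * (Y ^ a * scalar h) * Y ^ s * Z +
      ?C * (Y ^ (a + ?t) * scalar p) * Y * Z"
    by (simp add: algebra_simps)
  also have "\<dots> = scalar (q ^ a) * scalar q * (Y ^ a * Y) * X +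
      scalar (q ^ a) * scalar h * (Y ^ a * Y ^ s) * Z +
      ?C * scalar p * (Y ^ (a + ?t) * Y) * Z"
    by (simp only: mult_commute_scalar[of "_ ^ _"] mult.assoc)
  also have "Y ^ a * Y = Y ^ Suc a"
    by (simp add: power_commutes)
  \<comment> \<open>Here \<open>s \<ge> 1\<close> enters:
    \<open>a + s = Suc a + (s - 1)\<close>.\<close>
  also have "Y ^ a * Y ^ s = Y ^ (Suc a + ?t)"
    using assms by (simp flip: power_add)
  also have "Y ^ (a + ?t) * Y = Y ^ (Suc a + ?t)"
    by (simp add: power_commutes)
  also have "scalar (q ^ a) * scalar q * Y ^ Suc a * X +
      scalar (q ^ a) * scalar h * Y ^ (Suc a + ?t) * Z + ?C * scalar p * Y ^ (Suc a + ?t) * Z =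
      scalar (q ^ Suc a) * Y ^ Suc a * X +
      scalar (h * pq_number p q (Suc a)) * Y ^ (Suc a + ?t) * Z"
    by (simp only: pq_number_Suc' power_Suc2 distrib_left distrib_right scalar_add mult_ac
        flip: scalar_mult)
       (simp add: algebra_simps)
  finally show ?case .
qed simp

text \<open>Only the letters \<open>X\<close> of \<open>u\<close> contribute to the range of the sum, as no rook fits into the
  columns of height \<open>0\<close> that stem from the trailing \<open>X\<close>s.\<close>

lemma cls_normal_order:
  fixes m :: nat
  assumes s: "s \<ge> 1"
  defines "R \<equiv> \<lambda>w. rook_number s h p q (board_of_word w)"
  defines "w \<equiv> \<lambda>u. u @ replicate m LX"
  shows "cls (word_prod free_ring X Y (w u)) =
    cls (\<Sum>k\<le>count_list u LX. scalar (R (w u) k) * Y ^ (count_list u LY + (s - 1) * k) * Z ^ k *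
      X ^ (count_list u LX + m - k))"
proof (induction u)
  case Nil
  have "word_prod free_ring X Y (replicate m LX) = X ^ m"
    by (induction m) simp_all
  then show ?case
    using s by (simp add: w_def R_def rook_number_replicate_LX)
next
  case (Cons a u)
  let ?K = "count_list u LX" and ?N = "count_list u LY"
  let ?e = "\<lambda>k. ?N + (s - 1) * k"
  have IH: "cls (word_prod free_ring X Y (w u)) =
    cls (\<Sum>k\<le>?K. scalar (R (w u) k) * Y ^ ?e k * Z ^ k * X ^ (?K + m - k))"
    using Cons.IH .
  show ?case
  proof (cases a)
    case LY
    have "cls (word_prod free_ring X Y (w (a # u))) = cls (Y * word_prod free_ring X Y (w u) * 1)"
      by (simp add: w_def LY)
    also have "\<dots> = cls (Y * (\<Sum>k\<le>?K. scalar (R (w u) k) * Y ^ ?e k * Z ^ k * X ^ (?K + m - k)) * 1)"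
      by (intro cls_mult_cong IH)
    also have "Y * (\<Sum>k\<le>?K. scalar (R (w u) k) * Y ^ ?e k * Z ^ k * X ^ (?K + m - k)) * 1 =
      (\<Sum>k\<le>?K. scalar (R (w u) k) * Y ^ Suc (?e k) * Z ^ k * X ^ (?K + m - k))"
      by (simp add: sum_distrib_left mult_commute_scalar[of Y] flip: mult.assoc)
    finally show ?thesis
      by (simp add: LY R_def w_def)
  next
    case LX
    \<comment> \<open>\<open>?g k\<close> belongs to an empty new column, \<open>?f k\<close> to a
      rook in it; the latter therefore contributes at index \<open>Suc k\<close>.\<close>
    let ?f = "\<lambda>k. scalar (h * pq_number p q (?e k) * R (w u) k) * Y ^ ?e (Suc k) * Z ^ Suc k *
      X ^ (?K + m - k)"
    let ?g = "\<lambda>k. scalar (p ^ k * q ^ ?e k * R (w u) k) * Y ^ ?e k * Z ^ k * X ^ (Suc ?K + m - k)"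
    \<comment> \<open>In the first term of \<open>cls_X_Y_pow\<close> the \<open>X\<close> still has
      to pass \<open>Z ^ k\<close>; in the second it has been replaced by a \<open>Z\<close> that
      joins \<open>Z ^ k\<close>.\<close>
    have step: "cls (X * (scalar (R (w u) k) * Y ^ ?e k * Z ^ k * X ^ (?K + m - k))) =
        cls (?g k + ?f k)" if "k \<le> ?K" for k
    proof -
      let ?r = "scalar (R (w u) k)" and ?q = "scalar (q ^ ?e k)"
        and ?G = "scalar (h * pq_number p q (?e k))" and ?x = "X ^ (?K + m - k)"
      have "X * (?r * Y ^ ?e k * Z ^ k * ?x) = ?r * (X * Y ^ ?e k) * (Z ^ k * ?x)"
        by (simp only: mult_commute_scalar[of X] flip: mult.assoc)
      also have "cls \<dots> = cls (?r * (?q * Y ^ ?e k * X + ?G * Y ^ (?e k + (s - 1)) * Z) * (Z ^ k * ?x))"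
        by (intro cls_mult_cong cls_X_Y_pow s)
      also have "\<dots> = cls (?r * ?q * Y ^ ?e k * (X * Z ^ k) * ?x +
          1 * (?r * ?G * Y ^ (?e k + (s - 1)) * Z ^ Suc k * ?x) * 1)"
        by (simp add: algebra_simps)
      also have "\<dots> = cls (?r * ?q * Y ^ ?e k * (scalar (p ^ k) * Z ^ k * X) * ?x +
          1 * (?r * ?G * Y ^ (?e k + (s - 1)) * Z ^ Suc k * ?x) * 1)"
        by (intro cls_add_cong cls_mult_cong cls_X_Z_pow refl)
      also have "?r * ?G * Y ^ (?e k + (s - 1)) * Z ^ Suc k * ?x = ?f k"
        by (simp add: mult_ac add_ac flip: scalar_mult)
      also have "?r * ?q * Y ^ ?e k * (scalar (p ^ k) * Z ^ k * X) * ?x =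
          ?r * ?q * (Y ^ ?e k * scalar (p ^ k)) * Z ^ k * (X * ?x)"
        by (simp only: mult.assoc)
      also have "\<dots> = ?r * ?q * scalar (p ^ k) * Y ^ ?e k * Z ^ k * (X * ?x)"
        by (simp only: mult_commute_scalar[of "Y ^ _"] mult.assoc)
      also have "?r * ?q * scalar (p ^ k) = scalar (p ^ k * q ^ ?e k * R (w u) k)"
        by (simp only: mult_ac flip: scalar_mult)
      \<comment> \<open>The bound on \<open>k\<close> keeps the exponent from being
        truncated.\<close>
      also have "X * ?x = X ^ (Suc ?K + m - k)"
        using that by (simp add: Suc_diff_le flip: power_Suc)
      finally show ?thesis by simp
    qed
    have "w (LX # u) = LX # w u" and "count_list (w u) LY = ?N"
      by (simp_all add: w_def)
    then have R_Cons: "R (w (LX # u)) k = p ^ k * q ^ ?e k * R (w u) k +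
        (case k of 0 \<Rightarrow> 0 | Suc j \<Rightarrow> h * pq_number p q (?e j) * R (w u) j)" for k
      by (simp only: R_def rook_number_LX[OF s])
    have "cls (word_prod free_ring X Y (w (a # u))) = cls (X * word_prod free_ring X Y (w u) * 1)"
      by (simp add: w_def LX)
    also have "\<dots> = cls (X * (\<Sum>k\<le>?K. scalar (R (w u) k) * Y ^ ?e k * Z ^ k * X ^ (?K + m - k)) * 1)"
      by (intro cls_mult_cong IH)
    also have "\<dots> = cls (\<Sum>k\<le>?K. X * (scalar (R (w u) k) * Y ^ ?e k * Z ^ k * X ^ (?K + m - k)))"
      by (simp add: sum_distrib_left)
    also have "\<dots> = cls (\<Sum>k\<le>?K. ?g k + ?f k)"
      by (intro cls_sum_cong step)
    \<comment> \<open>The added term \<open>?g (Suc ?K)\<close> is zero, since \<open>u\<close> has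
      only \<open>?K\<close> letters \<open>X\<close>.\<close>
    also have "(\<Sum>k\<le>?K. ?g k + ?f k) = (\<Sum>k\<le>Suc ?K. ?g k) + (\<Sum>k\<le>?K. ?f k)"
      using rook_number_eq_0[OF s lessI] by (simp add: sum.distrib R_def w_def)
    \<comment> \<open>The shift lets the rook term from \<open>j\<close> meet the empty-column term
      at \<open>Suc j\<close>, as in \<open>R_Cons\<close>.\<close>
    also have "(\<Sum>k\<le>?K. ?f k) = (\<Sum>k\<le>Suc ?K. case k of 0 \<Rightarrow> 0 | Suc j \<Rightarrow> ?f j)"
      by (subst sum.atMost_Suc_shift) simp
    also have "(\<Sum>k\<le>Suc ?K. ?g k) + \<dots> =
        (\<Sum>k\<le>Suc ?K. scalar (R (w (a # u)) k) * Y ^ ?e k * Z ^ k * X ^ (Suc ?K + m - k))"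
      unfolding sum.distrib[symmetric]
      by (intro sum.cong refl) (simp add: LX R_Cons scalar_add distrib_right split: nat.split)
    finally show ?thesis
      by (simp add: LX)
  qed
qed

end

section \<open>Block words\<close>

text \<open>The block with index 1 stands last in the word; splitting it off exposes the trailing
  \<open>X\<close>s in the shape that \<open>cls_normal_order\<close> expects.\<close>

lemma block_word_Suc:
  "block_word (Suc r) m n =
    (concat (map (\<lambda>j. replicate (n j) LY @ replicate (m j) LX) (rev [2..<Suc (Suc r)])) @
      replicate (n 1) LY) @ replicate (m 1) LX"
  by (simp add: block_word_def upt_conv_Cons numeral_2_eq_2 del: upt_Suc)

lemma count_list_block_word:
  "count_list (block_word r m n) LX = (\<Sum>j=1..r. m j)"
  "count_list (block_word r m n) LY = (\<Sum>j=1..r. n j)"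
  by (induction r) (simp_all add: block_word_def count_list_replicate)

theorem theorem4p15:
  fixes s r :: nat and h p q :: complex and m n :: "nat \<Rightarrow> nat"
  assumes "s \<ge> 1" and "h \<noteq> 0" and "r \<ge> 1"
  shows "let A = weyl_algebra s h p q;
             X = weyl_class s h p q (gen_elem GX);
             Y = weyl_class s h p q (gen_elem GY);
             Z = weyl_class s h p q (gen_elem GZ);
             w = block_word r m n;
             M = (\<Sum>j=1..r. m j);
             N = (\<Sum>j=1..r. n j)
         in word_prod A X Y w =
            (\<Oplus>\<^bsub>A\<^esub> k\<in>{0..M - m 1}.
               weyl_class s h p q (scalar (rook_number s h p q (board_of_word w) k))
                 \<otimes>\<^bsub>A\<^esub> Y [^]\<^bsub>A\<^esub> (N + (s - 1) * k)
                 \<otimes>\<^bsub>A\<^esub> Z [^]\<^bsub>A\<^esub> k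
                 \<otimes>\<^bsub>A\<^esub> X [^]\<^bsub>A\<^esub> (M - k))"
proof -
  obtain u where u: "block_word r m n = u @ replicate (m 1) LX"
    using block_word_Suc[of "r - 1" m n] assms(3) by auto
  have M: "count_list u LX + m 1 = (\<Sum>j=1..r. m j)" and N: "count_list u LY = (\<Sum>j=1..r. n j)"
    using count_list_block_word[of r m n] by (simp_all add: u count_list_replicate)
  \<comment> \<open>The upper summation limit is the number of \<open>X\<close>s in
    \<open>u\<close>, so the difference is not truncated.\<close>
  have "count_list u LX = (\<Sum>j=1..r. m j) - m 1"
    using M by simp
  with M N show ?thesis
    using cls_normal_order[OF assms(1), where h = h and p = p and q = q and m = "m 1" and u = u]
    by (simp add: Let_def u cls_word_prod cls_sum cls_mult cls_pow flip: atLeast0AtMost)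
qed

end
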